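(* Let $(G,\oplus)$ be a normed gyrogroup with gyronorm $\|\cdot\|\colon G\to\mathbb{R}$. Define $d(x,y)=\|\ominus x\oplus y\|$ for all $x,y\in G$. Then $d$ is a metric on $G$, and so $(G,d)$ forms a metric space.
   Context: A gyrogroup is a nonempty set $G$ with a binary operation $\oplus$ such that: (G1) there is an element $e\in G$ with $e\oplus a=a$ for all $a\in G$; (G2) for each $a\in G$ there is $b\in G$ with $b\oplus a=e$; (G3) for all $a,b\in G$ there is an automorphism $\mathrm{gyr}[a,b]$ of $(G,\oplus)$ (a bijection $G\to G$ preserving $\oplus$) such that $a\oplus(b\oplus c)=(a\oplus b)\oplus\mathrm{gyr}[a,b]c$ for all $c\in G$; (G4) $\mathrm{gyr}[a\oplus b,b]=\mathrm{gyr}[a,b]$ for all $a,b\in G$. Then $e$ is the unique two-sided identity and each $a$ has a unique two-sided inverse $\ominus a$; $\mathrm{gyr}[a,b]$ is called the gyroautomorphism generated by $a$ and $b$. A gyronorm on a gyrogroup $G$ is a function $\|\cdot\|\colon G\to\mathbb{R}$ such that: (1) $\|x\|\ge 0$ for all $x\in G$, and $\|x\|=0$ if and only if $x=e$; (2) $\|\ominus x\|=\|x\|$ for all $x\in G$; (3) $\|x\oplus y\|\le\|x\|+\|y\|$ for all $x,y\in G$; (4) $\|\mathrm{gyr}[a,b]x\|=\|x\|$ for all $a,b,x\in G$. A normed gyrogroup is a gyrogroup equipped with a gyronorm. *)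

theory Defs
  imports "HOL-Analysis.Abstract_Metric_Spaces"
begin

text \<open>
  The identity \<open>e\<close> and the family \<open>gyr\<close>, whose existence is asserted by the gyrogroup axioms, are
  parameters of the locale; both are determined on the carrier by \<open>G\<close> and the operation. Equality
  of gyroautomorphisms means agreement on \<open>G\<close>, and \<open>G \<noteq> {}\<close> follows from \<open>e \<in> G\<close>.
\<close>

locale gyrogroup =
  fixes G :: "'a set"
    and oplus :: "'a \<Rightarrow> 'a \<Rightarrow> 'a" (infixl "\<oplus>" 65)
    and e :: 'a
    and gyr :: "'a \<Rightarrow> 'a \<Rightarrow> 'a \<Rightarrow> 'a"
  assumes oplus_closed: "\<lbrakk>a \<in> G; b \<in> G\<rbrakk> \<Longrightarrow> a \<oplus> b \<in> G"
    and id_closed: "e \<in> G"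
    and left_id: "a \<in> G \<Longrightarrow> e \<oplus> a = a"
    and left_inv_ex: "a \<in> G \<Longrightarrow> \<exists>b\<in>G. b \<oplus> a = e"
    and gyr_bij: "\<lbrakk>a \<in> G; b \<in> G\<rbrakk> \<Longrightarrow> bij_betw (gyr a b) G G"
    and gyr_oplus: "\<lbrakk>a \<in> G; b \<in> G; x \<in> G; y \<in> G\<rbrakk>
      \<Longrightarrow> gyr a b (x \<oplus> y) = gyr a b x \<oplus> gyr a b y"
    and left_gyroassoc: "\<lbrakk>a \<in> G; b \<in> G; c \<in> G\<rbrakk>
      \<Longrightarrow> a \<oplus> (b \<oplus> c) = (a \<oplus> b) \<oplus> gyr a b c"
    and left_loop: "\<lbrakk>a \<in> G; b \<in> G; c \<in> G\<rbrakk> \<Longrightarrow> gyr (a \<oplus> b) b c = gyr a b c"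

definition gyro_inv :: "'a set \<Rightarrow> ('a \<Rightarrow> 'a \<Rightarrow> 'a) \<Rightarrow> 'a \<Rightarrow> 'a \<Rightarrow> 'a" where
  "gyro_inv G oplus e a = (THE b. b \<in> G \<and> oplus b a = e \<and> oplus a b = e)"

locale normed_gyrogroup = gyrogroup +
  fixes nrm :: "'a \<Rightarrow> real"
  assumes nrm_nonneg: "x \<in> G \<Longrightarrow> nrm x \<ge> 0"
    and nrm_eq_0_iff: "x \<in> G \<Longrightarrow> nrm x = 0 \<longleftrightarrow> x = e"
    and nrm_inv: "x \<in> G \<Longrightarrow> nrm (gyro_inv G oplus e x) = nrm x"
    and nrm_triangle: "\<lbrakk>x \<in> G; y \<in> G\<rbrakk> \<Longrightarrow> nrm (x \<oplus> y) \<le> nrm x + nrm y"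
    and nrm_gyr: "\<lbrakk>a \<in> G; b \<in> G; x \<in> G\<rbrakk> \<Longrightarrow> nrm (gyr a b x) = nrm x"

text \<open>
  The distance is only meaningful on \<open>G \<times> G\<close>. It is set to \<open>0\<close> elsewhere because the locale
  \<open>Metric_space\<close> requires nonnegativity and symmetry on the whole type, not just on the carrier.
\<close>

definition gyronorm_dist ::
    "'a set \<Rightarrow> ('a \<Rightarrow> 'a \<Rightarrow> 'a) \<Rightarrow> 'a \<Rightarrow> ('a \<Rightarrow> real) \<Rightarrow> 'a \<Rightarrow> 'a \<Rightarrow> real" where
  "gyronorm_dist G oplus e nrm x y =
     (if x \<in> G \<and> y \<in> G then nrm (oplus (gyro_inv G oplus e x) y) else 0)"

end

theory Submission
  imports Defs
begin

text \<open>
  Both the triangle inequality and the symmetry of the distance come from the single identity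
  \<open>\<ominus>x \<oplus> z = (\<ominus>x \<oplus> y) \<oplus> gyr[\<ominus>x, y] (\<ominus>y \<oplus> z)\<close>: the triangle inequality because the norm is
  subadditive and invariant under gyrations, symmetry because for \<open>z = x\<close> it exhibits the inverse
  of \<open>\<ominus>x \<oplus> y\<close> as a gyration of \<open>\<ominus>y \<oplus> x\<close>.
\<close>

context gyrogroup
begin

abbreviation ginv :: "'a \<Rightarrow> 'a" (\<open>\<ominus> _\<close> [81] 80)
  where "\<ominus> a \<equiv> gyro_inv G (\<oplus>) e a"

lemma gyr_closed: "\<lbrakk>a \<in> G; b \<in> G; c \<in> G\<rbrakk> \<Longrightarrow> gyr a b c \<in> G"
  using gyr_bij bij_betwE by blast

text \<open>Adding a left inverse \<open>a'\<close> of \<open>a\<close> turns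
  \<open>a \<oplus> x\<close> into \<open>e \<oplus> gyr a' a x = gyr a' a x\<close>, and gyrations
  are injective. Only the left-sided axioms are available at this point.\<close>

lemma left_cancel:
  assumes "a \<in> G" "c \<in> G" "d \<in> G"
  shows "a \<oplus> c = a \<oplus> d \<longleftrightarrow> c = d"
proof
  assume eq: "a \<oplus> c = a \<oplus> d"
  obtain a' where a': "a' \<in> G" "a' \<oplus> a = e"
    using left_inv_ex assms(1) by blast
  have *: "a' \<oplus> (a \<oplus> x) = gyr a' a x" if "x \<in> G" for x
    using left_gyroassoc[OF a'(1) assms(1) that] a' assms(1) that
    by (simp add: left_id gyr_closed)
  have "gyr a' a c = gyr a' a d"
    using eq * assms by metis
  then show "c = d"
    using gyr_bij[OF a'(1) assms(1)] assms by (auto simp: bij_betw_def inj_on_def)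
qed simp

text \<open>Gyroassociativity with first entry \<open>e\<close> gives
  \<open>a \<oplus> c = a \<oplus> gyr e a c\<close>; then cancel \<open>a\<close>.\<close>

lemma gyr_left_id:
  assumes "a \<in> G" "c \<in> G"
  shows "gyr e a c = c"
proof -
  have "a \<oplus> gyr e a c = a \<oplus> c"
    using left_gyroassoc[OF id_closed assms] assms by (simp add: left_id oplus_closed)
  then show ?thesis
    using assms by (simp add: left_cancel gyr_closed id_closed)
qed

lemma left_inv_cancel:
  assumes "b \<in> G" "a \<in> G" "c \<in> G" "b \<oplus> a = e"
  shows "b \<oplus> (a \<oplus> c) = c"
proof -
  \<comment> \<open>Since \<open>b \<oplus> a = e\<close>, the loop property identifies
    \<open>gyr b a\<close> with \<open>gyr e a\<close>, which is trivial.\<close>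
  have "gyr b a c = c"
    using left_loop[OF assms(1,2,3)] assms by (simp add: gyr_left_id)
  then show ?thesis
    using left_gyroassoc[OF assms(1,2,3)] assms by (simp add: left_id)
qed

lemma left_inv_imp_right_inv:
  assumes "b \<in> G" "a \<in> G" "b \<oplus> a = e"
  shows "a \<oplus> b = e"
proof -
  \<comment> \<open>Both sides equal \<open>e\<close>. As every element has a left inverse,
    cancelling it makes \<open>e\<close> a right identity.\<close>
  have "b \<oplus> (a \<oplus> e) = b \<oplus> a" if "b \<in> G" "a \<in> G" "b \<oplus> a = e" for a b
    using that by (simp add: left_inv_cancel id_closed)
  then have right_id: "a \<oplus> e = a" if "a \<in> G" for a
    using that left_inv_ex left_cancel oplus_closed id_closed by metis
  have "b \<oplus> (a \<oplus> b) = b \<oplus> e"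
    using assms by (simp add: left_inv_cancel right_id)
  then show ?thesis
    using assms by (simp add: left_cancel oplus_closed id_closed)
qed

lemma ginv:
  assumes "a \<in> G"
  shows "\<ominus> a \<in> G \<and> \<ominus> a \<oplus> a = e \<and> a \<oplus> \<ominus> a = e"
  unfolding gyro_inv_def
proof (rule theI')
  show "\<exists>!b. b \<in> G \<and> b \<oplus> a = e \<and> a \<oplus> b = e"
    \<comment> \<open>Uniqueness: two candidates \<open>b\<close>, \<open>c\<close> satisfy
      \<open>a \<oplus> b = e = a \<oplus> c\<close>, so cancelling \<open>a\<close>
      suffices.\<close>
    using left_inv_ex[OF assms] left_inv_imp_right_inv left_cancel assms by metis
qed

lemma ginv_closed: "a \<in> G \<Longrightarrow> \<ominus> a \<in> G"
  and left_ginv: "a \<in> G \<Longrightarrow> \<ominus> a \<oplus> a = e"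
  and right_ginv: "a \<in> G \<Longrightarrow> a \<oplus> \<ominus> a = e"
  using ginv by blast+

lemma ginv_unique:
  assumes "a \<in> G" "b \<in> G" "a \<oplus> b = e"
  shows "\<ominus> a = b"
  using assms left_cancel ginv_closed right_ginv by metis

lemma ginv_oplus_split:
  assumes "x \<in> G" "y \<in> G" "z \<in> G"
  shows "\<ominus> x \<oplus> z = (\<ominus> x \<oplus> y) \<oplus> gyr (\<ominus> x) y (\<ominus> y \<oplus> z)"
proof -
  \<comment> \<open>Here \<open>y\<close> acts as a left inverse of \<open>\<ominus> y\<close>.
    Expanding \<open>z\<close> this way lets gyroassociativity regroup the sum around
    \<open>y\<close>.\<close>
  have "y \<oplus> (\<ominus> y \<oplus> z) = z"
    using assms by (simp add: left_inv_cancel ginv_closed right_ginv)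
  then show ?thesis
    using left_gyroassoc[of "\<ominus> x" y "\<ominus> y \<oplus> z"] assms
    by (simp add: ginv_closed oplus_closed)
qed

lemma ginv_ginv_oplus:
  assumes "x \<in> G" "y \<in> G"
  shows "\<ominus> (\<ominus> x \<oplus> y) = gyr (\<ominus> x) y (\<ominus> y \<oplus> x)"
  using ginv_oplus_split[OF assms assms(1)] assms
  by (intro ginv_unique) (simp_all add: ginv_closed oplus_closed gyr_closed left_ginv)

lemma ginv_oplus_eq_id_iff:
  assumes "x \<in> G" "y \<in> G"
  shows "\<ominus> x \<oplus> y = e \<longleftrightarrow> x = y"
  \<comment> \<open>Write \<open>e\<close> as \<open>\<ominus> x \<oplus> x\<close> and cancel
    \<open>\<ominus> x\<close>.\<close>
  using left_cancel[of "\<ominus> x" x y] assms by (auto simp: ginv_closed left_ginv)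

end

context normed_gyrogroup
begin

lemma nrm_ginv_oplus_commute:
  assumes "x \<in> G" "y \<in> G"
  shows "nrm (\<ominus> x \<oplus> y) = nrm (\<ominus> y \<oplus> x)"
proof -
  have "nrm (\<ominus> x \<oplus> y) = nrm (\<ominus> (\<ominus> x \<oplus> y))"
    using assms by (simp add: nrm_inv ginv_closed oplus_closed)
  also have "\<dots> = nrm (\<ominus> y \<oplus> x)"
    using assms by (simp add: ginv_ginv_oplus nrm_gyr ginv_closed oplus_closed)
  finally show ?thesis .
qed

lemma nrm_ginv_oplus_triangle:
  assumes "x \<in> G" "y \<in> G" "z \<in> G"
  shows "nrm (\<ominus> x \<oplus> z) \<le> nrm (\<ominus> x \<oplus> y) + nrm (\<ominus> y \<oplus> z)"
proof -
  have "nrm (\<ominus> x \<oplus> z) \<le> nrm (\<ominus> x \<oplus> y) + nrm (gyr (\<ominus> x) y (\<ominus> y \<oplus> z))"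
    unfolding ginv_oplus_split[OF assms]
    using assms by (intro nrm_triangle) (simp_all add: ginv_closed oplus_closed gyr_closed)
  then show ?thesis
    using assms by (simp add: nrm_gyr ginv_closed oplus_closed)
qed

end

theorem theorem3p2:
  fixes G :: "'a set"
    and oplus :: "'a \<Rightarrow> 'a \<Rightarrow> 'a"
    and e :: 'a
    and gyr :: "'a \<Rightarrow> 'a \<Rightarrow> 'a \<Rightarrow> 'a"
    and nrm :: "'a \<Rightarrow> real"
  assumes "normed_gyrogroup G oplus e gyr nrm"
  shows "Metric_space G (gyronorm_dist G oplus e nrm)"
proof -
  interpret normed_gyrogroup G oplus e gyr nrm by fact
  show ?thesis
  proof
    \<comment> \<open>These two conditions range over the whole type; outside \<open>G\<close> the
      default distance 0 settles them.\<close>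
    fix x y
    show "0 \<le> gyronorm_dist G oplus e nrm x y"
      by (simp add: gyronorm_dist_def nrm_nonneg ginv_closed oplus_closed)
    show "gyronorm_dist G oplus e nrm x y = gyronorm_dist G oplus e nrm y x"
      by (simp add: gyronorm_dist_def nrm_ginv_oplus_commute)
  next
    fix x y
    assume "x \<in> G" "y \<in> G"
    then show "gyronorm_dist G oplus e nrm x y = 0 \<longleftrightarrow> x = y"
      by (simp add: gyronorm_dist_def nrm_eq_0_iff ginv_oplus_eq_id_iff ginv_closed oplus_closed)
  next
    fix x y z
    assume "x \<in> G" "y \<in> G" "z \<in> G"
    then show "gyronorm_dist G oplus e nrm x z
        \<le> gyronorm_dist G oplus e nrm x y + gyronorm_dist G oplus e nrm y z"
      by (simp add: gyronorm_dist_def nrm_ginv_oplus_triangle)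
  qed
qed

end
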